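(* Let $K$ be a field of characteristic $0$, let $\ell\ge2$, let $0\le k\le\ell$, and let $n_1,\dots,n_\ell$ be any positive integers. The divisor in $\mathbb{A}^\ell$ defined by $$F_k=p\cdot\prod_{1\le i<j\le\ell}(x_i^{n_i}-x_j^{n_j})\in K[x_1,\dots,x_\ell],\qquad p=\begin{cases}1,&k=0\\ x_1\cdots x_k,&1\le k\le\ell,\end{cases}$$ is free.
   Context: For a reduced polynomial $f\in R=K[x_1,\dots,x_\ell]$, $\mathrm{Der}(f)=\{\delta\in\mathrm{Der}_K(R):\delta(f)\in Rf\}$. The divisor in $\mathbb{A}^\ell$ defined by $f$ is free if $\mathrm{Der}(f)$ is a free $R$-module. *)

theory Defs
  imports
    Complex_Main
    "HOL-Library.Cardinality"
    "HOL-Library.Poly_Mapping"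
    "HOL-Library.Function_Algebras"
    "HOL-Computational_Algebra.Squarefree"
begin

text \<open>
  The polynomial ring \<open>K[x\<^sub>1, \<dots>, x\<^sub>\<ell>]\<close> is the type \<open>('n, 'k) mpoly\<close> of finitely supported maps
  from monomials (exponent vectors) to coefficients, where \<open>'n\<close> is a finite linear order with
  \<open>\<ell> = CARD('n)\<close> elements: \<open>x\<^sub>i\<close> is the variable of the \<open>i\<close>-th smallest element of \<open>'n\<close>.
\<close>

type_synonym ('n, 'k) mpoly = "('n \<Rightarrow>\<^sub>0 nat) \<Rightarrow>\<^sub>0 'k"

definition Const :: "'k::zero \<Rightarrow> ('n, 'k) mpoly" where
  "Const c = Poly_Mapping.single 0 c"

definition Var :: "'n \<Rightarrow> ('n, 'k::zero_neq_one) mpoly" where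
  "Var i = Poly_Mapping.single (Poly_Mapping.single i 1) 1"

definition derivation :: "(('n, 'k::comm_ring_1) mpoly \<Rightarrow> ('n, 'k) mpoly) \<Rightarrow> bool" where
  "derivation \<delta> \<longleftrightarrow>
     (\<forall>f g. \<delta> (f + g) = \<delta> f + \<delta> g) \<and>
     (\<forall>c f. \<delta> (Const c * f) = Const c * \<delta> f) \<and>
     (\<forall>f g. \<delta> (f * g) = f * \<delta> g + g * \<delta> f)"

definition Der :: "('n, 'k::comm_ring_1) mpoly \<Rightarrow> (('n, 'k) mpoly \<Rightarrow> ('n, 'k) mpoly) set" where
  "Der f = {\<delta>. derivation \<delta> \<and> f dvd \<delta> f}"

text \<open>All maps into a commutative ring form a module over it, with pointwise operations.\<close>

definition scale_fun :: "'r::comm_ring_1 \<Rightarrow> ('a \<Rightarrow> 'r) \<Rightarrow> 'a \<Rightarrow> 'r" where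
  "scale_fun r \<delta> = (\<lambda>x. r * \<delta> x)"

interpretation fun_module: module scale_fun
  by unfold_locales (auto simp: scale_fun_def fun_eq_iff algebra_simps)

lemma subspace_Der: "fun_module.subspace (Der f)"
  by (auto simp: fun_module.subspace_def Der_def derivation_def scale_fun_def algebra_simps)

definition free_submodule :: "('a \<Rightarrow> 'r::comm_ring_1) set \<Rightarrow> bool" where
  "free_submodule M \<longleftrightarrow> (\<exists>B. fun_module.independent B \<and> fun_module.span B = M)"

text \<open>
  Freeness is a notion for reduced defining equations only, so \<open>squarefree f\<close> is part of it.
\<close>

definition free_divisor :: "('n, 'k::comm_ring_1) mpoly \<Rightarrow> bool" where
  "free_divisor f \<longleftrightarrow> squarefree f \<and> free_submodule (Der f)"

definition first_elems :: "nat \<Rightarrow> 'n::{finite,linorder} set" where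
  "first_elems k = set (take k (sorted_list_of_set UNIV))"

definition F_poly :: "('n::{finite,linorder} \<Rightarrow> nat) \<Rightarrow> nat \<Rightarrow> ('n, 'k::comm_ring_1) mpoly" where
  "F_poly n k = (\<Prod>i\<in>first_elems k. Var i) *
           (\<Prod>(i, j) \<in> {(i, j). i < j}. Var i ^ n i - Var j ^ n j)"

end

theory Submission
  imports Defs "HOL-Computational_Algebra.Polynomial"
begin

text \<open>
  Put \<open>y\<^sub>i = x\<^sub>i ^ n\<^sub>i\<close>. The factors \<open>x\<^sub>i\<close> and \<open>y\<^sub>i - y\<^sub>j\<close> of \<open>F\<^sub>k\<close> are pairwise coprime, so
  \<open>\<delta> \<in> Der F\<^sub>k\<close> means that \<open>x\<^sub>i\<close> divides \<open>\<delta> x\<^sub>i\<close> for \<open>i \<le> k\<close> and \<open>y\<^sub>i - y\<^sub>j\<close> divides \<open>\<delta> y\<^sub>i - \<delta> y\<^sub>j\<close>.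
  Newton interpolation then yields a polynomial \<open>P\<close> over \<open>R\<close> of degree below \<open>\<ell>\<close> with
  \<open>P(y\<^sub>i) = \<delta> y\<^sub>i\<close> for all \<open>i\<close>. Since \<open>x\<^sub>i ^ m\<^sub>i\<close> divides \<open>y\<^sub>i\<close> and \<open>\<delta> y\<^sub>i\<close>, where \<open>m\<^sub>i = n\<^sub>i\<close> for \<open>i \<le> k\<close> and
  \<open>m\<^sub>i = n\<^sub>i - 1\<close> otherwise, \<open>W = \<Prod>\<^sub>j x\<^sub>j ^ m\<^sub>j\<close> divides the constant coefficient of \<open>P\<close>. Hence the
  derivations \<open>\<theta>\<^sub>0, \<dots>, \<theta>\<^bsub>\<ell> - 1\<^esub>\<close> with \<open>\<theta>\<^sub>0 y\<^sub>i = W\<close> and \<open>\<theta>\<^sub>s y\<^sub>i = y\<^sub>i ^ s\<close> for \<open>s > 0\<close> generate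
  \<open>Der F\<^sub>k\<close>, and they are independent because the \<open>y\<^sub>i\<close> are distinct.

  For squarefreeness, \<open>F\<^sub>k\<close> and \<open>\<partial>F\<^sub>k/\<partial>x\<^sub>i\<close> generate a nonzero element free of \<open>x\<^sub>i\<close>. So if \<open>h\<^sup>2\<close> divides
  \<open>F\<^sub>k\<close>, then \<open>h\<close> divides such an element for each \<open>i\<close>; thus \<open>h\<close> contains no variable at all.
\<close>

section \<open>Monomials and ring generators\<close>

lemma poly_mapping_eq_sum_single:
  "f = (\<Sum>m\<in>Poly_Mapping.keys f. Poly_Mapping.single m (Poly_Mapping.lookup f m))"
  by (rule poly_mapping_eqI)
     (simp add: lookup_sum lookup_single when_def sum.delta in_keys_iff)

lemma single_eq_Const_mult_prod_Var:
  fixes m :: "'n::finite \<Rightarrow>\<^sub>0 nat" and c :: "'k::comm_semiring_1"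
  shows "Poly_Mapping.single m c = Const c * (\<Prod>j\<in>UNIV. Var j ^ Poly_Mapping.lookup m j)"
proof -
  have pow: "Var j ^ e = (Poly_Mapping.single (Poly_Mapping.single j e) 1 :: ('n, 'k) mpoly)" for j e
    by (induction e) (simp_all add: Var_def mult_single flip: single_add)
  have prod: "(\<Prod>j\<in>S. Poly_Mapping.single (g j) 1) = (Poly_Mapping.single (sum g S) 1 :: ('n, 'k) mpoly)"
    if "finite S" for g and S :: "'n set"
    using that by induction (simp_all add: mult_single)
  have "(\<Sum>j\<in>UNIV. Poly_Mapping.single j (Poly_Mapping.lookup m j)) = m"
    by (rule poly_mapping_eqI) (simp add: lookup_sum lookup_single when_def sum.delta)
  then show ?thesis
    by (simp add: pow prod Const_def mult_single)
qed

lemma Const_simps: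
  "Const 0 = 0" "Const 1 = 1" "Const (c + d) = Const c + Const d" "Const (c * d) = Const c * Const d"
  by (simp_all add: Const_def single_add mult_single)

text \<open>Each monomial is a constant times a product of variables, so constants and variables
  generate the ring. Identities between additive and multiplicative maps or derivations then need
  checking only on these.\<close>

lemma mpoly_induct [case_names Const Var add mult]:
  fixes f :: "('n::finite, 'k::comm_semiring_1) mpoly"
  assumes C: "\<And>c. P (Const c)" and V: "\<And>i. P (Var i)"
    and add: "\<And>f g. P f \<Longrightarrow> P g \<Longrightarrow> P (f + g)"
    and mult: "\<And>f g. P f \<Longrightarrow> P g \<Longrightarrow> P (f * g)"
  shows "P f"
proof -
  have 1: "P 1" using C[of 1] by (simp add: Const_simps)
  have 0: "P 0" using C[of 0] by (simp add: Const_simps)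
  have pow: "P (Var j ^ e)" for j e
    by (induction e) (auto intro: 1 V mult)
  have "P (\<Prod>j\<in>S. Var j ^ Poly_Mapping.lookup m j)" if "finite S" for m and S :: "'n set"
    using that by induction (auto intro: 1 mult pow)
  then have single: "P (Poly_Mapping.single m c)" for m c
    unfolding single_eq_Const_mult_prod_Var by (intro mult C) auto
  have "P (\<Sum>m\<in>S. Poly_Mapping.single m (Poly_Mapping.lookup f m))" if "finite S" for S
    using that by induction (auto intro: 0 add single)
  then show ?thesis
    by (subst poly_mapping_eq_sum_single) simp
qed

text \<open>
  Only occurrences of \<open>x\<^sub>i\<close> are replaced by the new indeterminate; the coefficients stay in the full
  ring, so that evaluation at \<open>x\<^sub>i\<close> is a left inverse.
\<close>

definition as_poly :: "'n::finite \<Rightarrow> ('n, 'k::comm_ring_1) mpoly \<Rightarrow> ('n, 'k) mpoly poly" where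
  "as_poly i f = (\<Sum>m\<in>Poly_Mapping.keys f. [:Const (Poly_Mapping.lookup f m):] *
     (\<Prod>j\<in>UNIV. (if j = i then [:0, 1:] else [:Var j:]) ^ Poly_Mapping.lookup m j))"

lemma as_poly_add: "as_poly i (f + g) = as_poly i f + as_poly i g"
  unfolding as_poly_def
  by (rule setsum_keys_plus_distrib) (simp_all add: Const_simps smult_add_left)

lemma as_poly_0 [simp]: "as_poly i 0 = 0"
  by (simp add: as_poly_def)

lemma as_poly_sum: "as_poly i (sum f S) = (\<Sum>x\<in>S. as_poly i (f x))"
  by (induction S rule: infinite_finite_induct) (simp_all add: as_poly_add)

lemma as_poly_single:
  "as_poly i (Poly_Mapping.single m c) =
    [:Const c:] * (\<Prod>j\<in>UNIV. (if j = i then [:0, 1:] else [:Var j:]) ^ Poly_Mapping.lookup m j)"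
  by (cases "c = 0") (simp_all add: as_poly_def Const_simps)

lemma as_poly_mult: "as_poly i (f * g) = as_poly i f * as_poly i g"
proof -
  have single: "as_poly i (Poly_Mapping.single m c * Poly_Mapping.single m' c') =
      as_poly i (Poly_Mapping.single m c) * as_poly i (Poly_Mapping.single m' c')" for m m' c c'
    by (simp add: mult_single as_poly_single lookup_add power_add prod.distrib Const_simps mult_ac)
  let ?s = "\<lambda>f m. Poly_Mapping.single m (Poly_Mapping.lookup f m)"
  have "as_poly i ((\<Sum>m\<in>Poly_Mapping.keys f. ?s f m) * (\<Sum>m\<in>Poly_Mapping.keys g. ?s g m)) =
      as_poly i (\<Sum>m\<in>Poly_Mapping.keys f. ?s f m) * as_poly i (\<Sum>m\<in>Poly_Mapping.keys g. ?s g m)"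
    by (simp only: sum_product as_poly_sum single)
  then show ?thesis
    by (simp only: poly_mapping_eq_sum_single[symmetric])
qed

lemma as_poly_Const: "as_poly i (Const c) = [:Const c:]"
  by (simp add: Const_def as_poly_single)

lemma as_poly_Var: "as_poly i (Var j) = (if j = i then [:0, 1:] else [:Var j:])"
proof -
  let ?g = "\<lambda>l. if l = i then [:0, 1:] else [:Var l:]"
  have "(\<Prod>l\<in>UNIV. ?g l ^ Poly_Mapping.lookup (Poly_Mapping.single j (1::nat)) l) =
      (\<Prod>l\<in>UNIV. if l = j then ?g j else 1)"
    by (rule prod.cong) (auto simp: lookup_single)
  then show ?thesis
    by (simp add: Var_def as_poly_single Const_simps prod.delta del: prod.delta_remove)
qed

lemma poly_as_poly [simp]: "poly (as_poly i f) (Var i) = f"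
  by (induction f rule: mpoly_induct)
     (simp_all add: as_poly_Const as_poly_Var as_poly_add as_poly_mult)

lemma as_poly_1: "as_poly i 1 = 1"
  using as_poly_Const[of i 1] by (simp add: Const_simps one_pCons)

lemma as_poly_uminus: "as_poly i (- f) = - as_poly i f"
  using as_poly_add[of i f "- f"] by (simp add: eq_neg_iff_add_eq_0 add.commute)

lemma as_poly_diff: "as_poly i (f - g) = as_poly i f - as_poly i g"
  using as_poly_add[of i f "- g"] by (simp add: as_poly_uminus)

lemma as_poly_power: "as_poly i (f ^ e) = as_poly i f ^ e"
  by (induction e) (simp_all add: as_poly_1 as_poly_mult)

section \<open>Polynomials free of a given variable\<close>

definition not_in :: "'n::finite \<Rightarrow> ('n, 'k::comm_ring_1) mpoly \<Rightarrow> bool" where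
  "not_in i f \<longleftrightarrow> as_poly i f = [:f:]"

text \<open>Evaluation at \<open>Var i\<close> recovers \<open>f\<close>, so a constant
  \<open>as_poly i f\<close> can only be the constant \<open>f\<close>.\<close>

lemma not_in_iff_degree: "not_in i f \<longleftrightarrow> degree (as_poly i f) = 0"
proof
  assume "degree (as_poly i f) = 0"
  then obtain c where c: "as_poly i f = [:c:]"
    by (metis degree_eq_zeroE)
  with poly_as_poly[of i f] show "not_in i f"
    by (simp add: not_in_def)
qed (simp add: not_in_def)

lemma not_in_mult: "not_in i f \<Longrightarrow> not_in i g \<Longrightarrow> not_in i (f * g)"
  by (simp add: not_in_def as_poly_mult)

lemma not_in_diff: "not_in i f \<Longrightarrow> not_in i g \<Longrightarrow> not_in i (f - g)"
  by (simp add: not_in_def as_poly_diff)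

lemma not_in_power: "not_in i f \<Longrightarrow> not_in i (f ^ e)"
  by (induction e) (simp_all add: not_in_mult, simp add: not_in_def as_poly_1 one_pCons)

lemma not_in_Var: "j \<noteq> i \<Longrightarrow> not_in i (Var j)"
  by (simp add: not_in_def as_poly_Var)

lemma not_in_1: "not_in i 1"
  by (simp add: not_in_def as_poly_1 one_pCons)

lemma not_in_of_nat: "not_in i (of_nat e)"
  by (induction e) (simp_all add: not_in_def as_poly_add as_poly_1 one_pCons)

text \<open>Degrees in one variable add over an integral domain. The linear order on
  \<open>'n\<close> supplies the monomial order behind integrality.\<close>

lemma not_in_factor:
  fixes f g :: "('n::{finite,linorder}, 'k::idom) mpoly"
  assumes "not_in i (f * g)" "f * g \<noteq> 0"
  shows "not_in i f"
proof -
  have "as_poly i h \<noteq> 0" if "h \<noteq> 0" for h :: "('n, 'k) mpoly"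
    using that poly_as_poly[of i h] by (metis poly_0)
  with assms show ?thesis
    by (simp add: not_in_iff_degree as_poly_mult degree_mult_eq)
qed

text \<open>Setting one variable to 0 fixes a polynomial free of it but kills every monomial that
  contains it. Hence no monomial of \<open>f\<close> contains any variable.\<close>

lemma Const_if_not_in_any:
  fixes f :: "('n::finite, 'k::comm_ring_1) mpoly"
  assumes "\<And>i. not_in i f"
  shows "\<exists>c. f = Const c"
proof -
  have "Poly_Mapping.keys f \<subseteq> {m. Poly_Mapping.lookup m i = 0}" for i
  proof -
    define Z :: "('n, 'k) mpoly \<Rightarrow> ('n, 'k) mpoly" where "Z g = poly (as_poly i g) 0" for g
    have Z_single: "Z (Poly_Mapping.single m c) =
        (if Poly_Mapping.lookup m i = 0 then Poly_Mapping.single m c else 0)" for m c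
    proof -
      have eq: "Z (Poly_Mapping.single m c) =
          Const c * (\<Prod>j\<in>UNIV. (if j = i then 0 else Var j) ^ Poly_Mapping.lookup m j)"
        by (auto simp: Z_def as_poly_single poly_prod intro!: arg_cong2[of _ _ _ _ times] prod.cong)
      show ?thesis
      proof (cases "Poly_Mapping.lookup m i = 0")
        case True
        then have "(\<Prod>j\<in>UNIV. (if j = i then 0 else Var j) ^ Poly_Mapping.lookup m j) =
            (\<Prod>j\<in>UNIV. Var j ^ Poly_Mapping.lookup m j :: ('n, 'k) mpoly)"
          by (intro prod.cong) auto
        with True eq show ?thesis
          by (simp add: single_eq_Const_mult_prod_Var)
      next
        case False
        then have "(\<Prod>j\<in>UNIV. (if j = i then 0 else Var j) ^ Poly_Mapping.lookup m j) =
            (0 :: ('n, 'k) mpoly)"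
          by (subst prod.remove[of _ i]) (auto simp: zero_power)
        with False eq show ?thesis by simp
      qed
    qed
    have "f = Z f"
      using assms[of i] by (simp add: Z_def not_in_def)
    also have "\<dots> = (\<Sum>m\<in>Poly_Mapping.keys f. Z (Poly_Mapping.single m (Poly_Mapping.lookup f m)))"
      by (subst poly_mapping_eq_sum_single[of f]) (simp add: Z_def as_poly_sum poly_sum)
    finally have f: "f = \<dots>" .
    show ?thesis
      by (subst f, rule order.trans[OF keys_sum]) (auto simp: Z_single split: if_splits)
  qed
  then have "Poly_Mapping.lookup m i = 0" if "m \<in> Poly_Mapping.keys f" for m i
    using that by blast
  then have "Poly_Mapping.keys f \<subseteq> {0}"
    by (intro subsetI) (simp add: poly_mapping_eq_iff fun_eq_iff)
  then have "f = Const (Poly_Mapping.lookup f 0)"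
    by (intro poly_mapping_eqI) (auto simp: Const_def lookup_single when_def in_keys_iff)
  then show ?thesis ..
qed

section \<open>Monic division and nonzerodivisors modulo an element\<close>

lemma monic_division:
  fixes a f :: "'r::idom poly"
  assumes "lead_coeff a = 1" "degree a > 0"
  obtains q r where "f = q * a + r" "degree r < degree a"
proof -
  obtain q r where qr: "pseudo_divmod f a = (q, r)" by fastforce
  have "a \<noteq> 0" using assms by auto
  note * = pseudo_divmod[OF this qr]
  \<comment> \<open>The power of the leading coefficient by which pseudo-division scales
    \<open>f\<close> is 1.\<close>
  have "f = q * a + r"
    using *(1) by (simp add: assms(1) mult.commute[of q])
  moreover have "degree r < degree a"
    using *(2) assms(2) by auto
  ultimately show ?thesis ..
qed

text \<open>Multiplication by \<open>b\<close> is injective modulo \<open>a\<close>. This takes the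
  place of coprimality and avoids unique factorization.\<close>

definition regular_mod :: "'r::comm_ring_1 \<Rightarrow> 'r \<Rightarrow> bool" where
  "regular_mod a b \<longleftrightarrow> (\<forall>c. a dvd b * c \<longrightarrow> a dvd c)"

lemma regular_modD: "regular_mod a b \<Longrightarrow> a dvd b * c \<Longrightarrow> a dvd c"
  unfolding regular_mod_def by blast

lemma regular_mod_1: "regular_mod a 1"
  by (simp add: regular_mod_def)

lemma regular_mod_mult: "regular_mod a b \<Longrightarrow> regular_mod a c \<Longrightarrow> regular_mod a (b * c)"
  unfolding regular_mod_def mult.assoc by blast

lemma regular_mod_prod:
  "(\<And>t. t \<in> S \<Longrightarrow> regular_mod a (f t)) \<Longrightarrow> regular_mod a (prod f S)"
  by (induction S rule: infinite_finite_induct) (auto intro: regular_mod_mult regular_mod_1)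

text \<open>Write \<open>c\<close> as the product so far times \<open>d\<close>. That product is
  regular modulo the next factor, so the factor must divide \<open>d\<close>.\<close>

lemma prod_dvd_if_regular_mod:
  assumes "finite S" "\<And>t. t \<in> S \<Longrightarrow> f t dvd c"
    "\<And>s t. s \<in> S \<Longrightarrow> t \<in> S \<Longrightarrow> s \<noteq> t \<Longrightarrow> regular_mod (f s) (f t)"
  shows "prod f S dvd c"
  using assms
proof (induction S)
  case (insert t S)
  then have "prod f S dvd c" by blast
  then obtain d where d: "c = prod f S * d" ..
  have "regular_mod (f t) (prod f S)"
    using insert.prems(2) insert.hyps by (intro regular_mod_prod) auto
  moreover have "f t dvd prod f S * d"
    using insert.prems(1)[of t] d by simp
  ultimately have "f t dvd d" by (rule regular_modD)
  then have "prod f S * f t dvd c"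
    unfolding d by (rule mult_dvd_mono[OF dvd_refl])
  with insert.hyps show ?case
    by (simp add: mult.commute)
qed simp

text \<open>
  Dividing \<open>c\<close> by the monic \<open>x\<^sub>i ^ e - u\<close> leaves a remainder of \<open>x\<^sub>i\<close>-degree below \<open>e\<close>, and multiplying
  it by \<open>b\<close> does not raise this degree.
\<close>

lemma regular_mod_if_monic_in:
  fixes b u :: "('n::{finite,linorder}, 'k::idom) mpoly"
  assumes "e > 0" "not_in i u" "b \<noteq> 0" "not_in i b"
  shows "regular_mod (Var i ^ e - u) b"
  unfolding regular_mod_def
proof (intro allI impI)
  fix c assume "Var i ^ e - u dvd b * c"
  let ?a = "Var i ^ e - u"
  define A where "A = as_poly i ?a"
  have A: "A = [:0, 1:] ^ e - [:u:]"
    using assms(2) by (simp add: A_def not_in_def as_poly_diff as_poly_power as_poly_Var)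
  have deg_pow: "degree ([:0, 1:] ^ e :: ('n, 'k) mpoly poly) = e"
    by (rule degree_linear_power)
  \<comment> \<open>As \<open>e > 0\<close>, the constant \<open>u\<close> leaves the leading term
    alone.\<close>
  have deg: "degree A = e"
    unfolding A diff_conv_add_uminus using assms(1) deg_pow
    by (subst degree_add_eq_left) simp_all
  have lead: "lead_coeff A = 1"
    unfolding deg unfolding A using assms(1)
    by (simp add: coeff_linear_power coeff_pCons split: nat.splits)
  obtain q r where qr: "as_poly i c = q * A + r" "degree r < degree A"
    using monic_division[of A "as_poly i c"] lead deg assms(1) by blast
  from \<open>?a dvd b * c\<close> obtain d where "b * c = ?a * d" ..
  then have "as_poly i b * as_poly i c = A * as_poly i d"
    unfolding A_def as_poly_mult[symmetric] by (rule arg_cong)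
  then have eq: "smult b (q * A + r) = A * as_poly i d"
    using assms(4) by (simp add: not_in_def qr(1))
  have "smult b r = smult b (q * A + r) - smult b q * A"
    by (simp add: smult_add_right)
  also have "\<dots> = A * (as_poly i d - smult b q)"
    unfolding eq by (simp add: right_diff_distrib mult.commute[of A])
  finally have "A dvd smult b r" by simp
  moreover have "\<not> degree A \<le> degree (smult b r)"
    using qr(2) assms(3) by simp
  ultimately have "smult b r = 0"
    using divides_degree by blast
  then have "as_poly i c = q * A"
    using assms(3) qr(1) by simp
  \<comment> \<open>Evaluation at \<open>Var i\<close> carries the factorization back to the
    original ring.\<close>
  from arg_cong[OF this, of "\<lambda>p. poly p (Var i)"]
  have "poly (as_poly i c) (Var i) = poly q (Var i) * poly A (Var i)"
    by (simp only: poly_mult)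
  then have "c = poly q (Var i) * ?a"
    unfolding A_def poly_as_poly .
  then show "?a dvd c" by simp
qed

section \<open>Derivations\<close>

lemma derivation_add: "derivation \<delta> \<Longrightarrow> \<delta> (f + g) = \<delta> f + \<delta> g"
  and derivation_Const_mult: "derivation \<delta> \<Longrightarrow> \<delta> (Const c * f) = Const c * \<delta> f"
  and derivation_mult: "derivation \<delta> \<Longrightarrow> \<delta> (f * g) = f * \<delta> g + g * \<delta> f"
  unfolding derivation_def by blast+

lemma derivation_0: "derivation \<delta> \<Longrightarrow> \<delta> 0 = 0"
  using derivation_add[of \<delta> 0 0] by simp

lemma derivation_diff: "derivation \<delta> \<Longrightarrow> \<delta> (f - g) = \<delta> f - \<delta> g"
  using derivation_add[of \<delta> "f - g" g] by simp

lemma derivation_1: "derivation \<delta> \<Longrightarrow> \<delta> 1 = 0"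
  using derivation_mult[of \<delta> 1 1] by simp

lemma derivation_Const: "derivation \<delta> \<Longrightarrow> \<delta> (Const c) = 0"
  using derivation_Const_mult[of \<delta> c 1] by (simp add: derivation_1)

lemma derivation_power: "derivation \<delta> \<Longrightarrow> \<delta> (f ^ e) = of_nat e * f ^ (e - 1) * \<delta> f"
proof (induction e)
  case (Suc e)
  then show ?case
    by (cases e) (simp_all add: derivation_mult algebra_simps)
qed (simp add: derivation_1)

lemma derivation_eqI:
  fixes \<delta> \<epsilon> :: "('n::finite, 'k::comm_ring_1) mpoly \<Rightarrow> _"
  assumes "derivation \<delta>" "derivation \<epsilon>" "\<And>i. \<delta> (Var i) = \<epsilon> (Var i)"
  shows "\<delta> = \<epsilon>"
proof
  fix f show "\<delta> f = \<epsilon> f"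
    using assms
    by (induction f rule: mpoly_induct)
       (simp_all add: derivation_Const derivation_add derivation_mult)
qed

text \<open>By the product rule, modulo \<open>f t\<close> only the cofactor times
  \<open>\<delta> (f t)\<close> remains of \<open>\<delta> (prod f S)\<close>, and the cofactor is
  regular modulo \<open>f t\<close>.\<close>

lemma derivation_dvd_prod_iff:
  fixes \<delta> :: "('n::finite, 'k::comm_ring_1) mpoly \<Rightarrow> _"
  assumes \<delta>: "derivation \<delta>" and "finite S"
    and reg: "\<And>s t. s \<in> S \<Longrightarrow> t \<in> S \<Longrightarrow> s \<noteq> t \<Longrightarrow> regular_mod (f s) (f t)"
  shows "prod f S dvd \<delta> (prod f S) \<longleftrightarrow> (\<forall>t\<in>S. f t dvd \<delta> (f t))"
proof
  assume dvd: "prod f S dvd \<delta> (prod f S)"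
  show "\<forall>t\<in>S. f t dvd \<delta> (f t)"
  proof
    fix t assume t: "t \<in> S"
    have eq: "prod f S = f t * prod f (S - {t})"
      using \<open>finite S\<close> t by (rule prod.remove)
    have "f t dvd prod f S" using eq by simp
    also note dvd
    finally have "f t dvd f t * \<delta> (prod f (S - {t})) + prod f (S - {t}) * \<delta> (f t)"
      unfolding eq derivation_mult[OF \<delta>] .
    then have "f t dvd prod f (S - {t}) * \<delta> (f t)"
      by (simp add: dvd_add_right_iff)
    moreover have "regular_mod (f t) (prod f (S - {t}))"
      using t by (intro regular_mod_prod reg) auto
    ultimately show "f t dvd \<delta> (f t)"
      by (blast intro: regular_modD)
  qed
next
  assume "\<forall>t\<in>S. f t dvd \<delta> (f t)"
  with \<open>finite S\<close> show "prod f S dvd \<delta> (prod f S)"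
  proof (induction S)
    case (insert t S)
    then have "prod f S dvd \<delta> (prod f S)" "f t dvd \<delta> (f t)" by simp_all
    then have "f t * prod f S dvd f t * \<delta> (prod f S)" "prod f S * f t dvd prod f S * \<delta> (f t)"
      by (auto intro: mult_dvd_mono)
    with insert.hyps show ?case
      by (simp add: derivation_mult[OF \<delta>] mult.commute[of "prod f S" "f t"])
  qed (simp add: derivation_1[OF \<delta>])
qed

text \<open>The sum of \<open>v i\<close> times the partial derivative in the variable
  \<open>i\<close>, which is taken in the new indeterminate and then evaluated back.\<close>

definition vector_field :: "('n::{finite,linorder} \<Rightarrow> ('n, 'k::idom) mpoly) \<Rightarrow> ('n, 'k) mpoly \<Rightarrow> ('n, 'k) mpoly" where
  "vector_field v f = (\<Sum>i\<in>UNIV. v i * poly (pderiv (as_poly i f)) (Var i))"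

lemma derivation_vector_field:
  fixes v :: "'n::{finite,linorder} \<Rightarrow> ('n, 'k::idom) mpoly"
  shows "derivation (vector_field v)"
  by (simp add: derivation_def vector_field_def as_poly_add as_poly_mult as_poly_Const pderiv_add
      pderiv_mult pderiv_smult pderiv_pCons algebra_simps sum.distrib sum_distrib_left)

lemma vector_field_Var:
  fixes v :: "'n::{finite,linorder} \<Rightarrow> ('n, 'k::idom) mpoly"
  shows "vector_field v (Var j) = v j"
proof -
  have "vector_field v (Var j) = (\<Sum>i\<in>UNIV. if i = j then v i else 0)"
    unfolding vector_field_def by (rule sum.cong) (auto simp: as_poly_Var pderiv_pCons)
  then show ?thesis by simp
qed

section \<open>Squarefree polynomials\<close>

text \<open>Coprimality as polynomials in \<open>Var i\<close> over the fraction field of the other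
  variables, with denominators cleared into \<open>r\<close>.\<close>

definition coprime_in :: "'n::{finite,linorder} \<Rightarrow> ('n, 'k::idom) mpoly \<Rightarrow> ('n, 'k) mpoly \<Rightarrow> bool" where
  "coprime_in i a b \<longleftrightarrow> (\<exists>u v r. r \<noteq> 0 \<and> not_in i r \<and> u * a + v * b = r)"

lemma coprime_inI: "u * a + v * b = r \<Longrightarrow> r \<noteq> 0 \<Longrightarrow> not_in i r \<Longrightarrow> coprime_in i a b"
  unfolding coprime_in_def by blast

lemma coprime_in_commute: "coprime_in i a b \<longleftrightarrow> coprime_in i b a"
  unfolding coprime_in_def by (metis add.commute)

lemma coprime_in_if_not_in: "a \<noteq> 0 \<Longrightarrow> not_in i a \<Longrightarrow> coprime_in i a b"
  by (rule coprime_inI[of 1 a 0]) simp_all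

lemma coprime_in_1: "coprime_in i (1 :: ('n::{finite,linorder}, 'k::idom) mpoly) b"
  by (rule coprime_in_if_not_in) (simp_all add: not_in_1)

lemma coprime_in_mult_left:
  fixes a b c :: "('n::{finite,linorder}, 'k::idom) mpoly"
  assumes "coprime_in i a c" "coprime_in i b c"
  shows "coprime_in i (a * b) c"
proof -
  obtain u v r where 1: "r \<noteq> 0" "not_in i r" "u * a + v * c = r"
    using assms(1) unfolding coprime_in_def by blast
  obtain u' v' r' where 2: "r' \<noteq> 0" "not_in i r'" "u' * b + v' * c = r'"
    using assms(2) unfolding coprime_in_def by blast
  \<comment> \<open>Obtained by multiplying the two relations and collecting the multiples of
    \<open>c\<close>.\<close>
  have "(u * u') * (a * b) + (u * a * v' + v * r') * c = r * r'"
    unfolding 1(3)[symmetric] 2(3)[symmetric] by (simp add: algebra_simps)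
  then show ?thesis
    by (rule coprime_inI) (use 1 2 in \<open>auto intro: not_in_mult\<close>)
qed

lemma coprime_in_prod_left:
  fixes f :: "'b \<Rightarrow> ('n::{finite,linorder}, 'k::idom) mpoly"
  shows "(\<And>t. t \<in> S \<Longrightarrow> coprime_in i (f t) c) \<Longrightarrow> coprime_in i (prod f S) c"
  by (induction S rule: infinite_finite_induct) (simp_all add: coprime_in_mult_left coprime_in_1)

lemma coprime_in_add_mult:
  assumes "coprime_in i a b" shows "coprime_in i a (b + a * d)"
proof -
  obtain u v r where 1: "r \<noteq> 0" "not_in i r" "u * a + v * b = r"
    using assms unfolding coprime_in_def by blast
  have "(u - v * d) * a + v * (b + a * d) = r"
    unfolding 1(3)[symmetric] by (simp add: algebra_simps)
  then show ?thesis using 1(1,2) by (rule coprime_inI)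
qed

text \<open>Modulo \<open>a\<close>, the derivative of \<open>a * b\<close> is
  \<open>b * \<delta> a\<close>, a product of two elements coprime to \<open>a\<close>; the same
  holds with \<open>a\<close> and \<open>b\<close> exchanged.\<close>

lemma coprime_in_derivation_mult:
  fixes a b :: "('n::{finite,linorder}, 'k::idom) mpoly"
  assumes \<delta>: "derivation \<delta>"
    and "coprime_in i a (\<delta> a)" "coprime_in i b (\<delta> b)" "coprime_in i a b"
  shows "coprime_in i (a * b) (\<delta> (a * b))"
proof -
  have *: "coprime_in i a (b * \<delta> a + a * \<delta> b)" if "coprime_in i a (\<delta> a)" "coprime_in i a b" for a b
    using that by (intro coprime_in_add_mult) (simp add: coprime_in_mult_left coprime_in_commute[of i a])
  show ?thesis
    using *[of a b] *[of b a] assms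
    by (intro coprime_in_mult_left) (simp_all add: derivation_mult add.commute coprime_in_commute)
qed

lemma coprime_in_derivation_prod:
  fixes f :: "'b \<Rightarrow> ('n::{finite,linorder}, 'k::idom) mpoly"
  assumes \<delta>: "derivation \<delta>" and "finite S"
    and "\<And>t. t \<in> S \<Longrightarrow> coprime_in i (f t) (\<delta> (f t))"
    and "\<And>s t. s \<in> S \<Longrightarrow> t \<in> S \<Longrightarrow> s \<noteq> t \<Longrightarrow> coprime_in i (f s) (f t)"
  shows "coprime_in i (prod f S) (\<delta> (prod f S))"
  using assms(2-)
proof (induction S)
  case (insert t S)
  have "coprime_in i (prod f S) (f t)"
    using insert.prems(2) insert.hyps by (intro coprime_in_prod_left) auto
  moreover have "coprime_in i (prod f S) (\<delta> (prod f S))"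
    using insert.prems by (intro insert.IH) auto
  moreover have "coprime_in i (f t) (\<delta> (f t))"
    using insert.prems by auto
  ultimately have "coprime_in i (f t * prod f S) (\<delta> (f t * prod f S))"
    by (intro coprime_in_derivation_mult[OF \<delta>]) (simp_all add: coprime_in_commute[of i "f t"])
  with insert.hyps show ?case
    by simp
qed (simp add: coprime_in_1)

lemma squarefree_if_coprime_in_derivation:
  fixes F :: "('n::{finite,linorder}, 'k::field) mpoly"
  assumes "\<And>i. \<exists>\<delta>. derivation \<delta> \<and> coprime_in i F (\<delta> F)"
  shows "squarefree F"
  unfolding squarefree_def
proof (intro allI impI)
  fix h assume "h\<^sup>2 dvd F"
  then obtain q where "F = h\<^sup>2 * q" ..
  then have F: "F = h * (h * q)"
    by (simp add: power2_eq_square mult.assoc)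
  have *: "h \<noteq> 0 \<and> not_in i h" for i
  proof -
    obtain \<delta> u v r where \<delta>: "derivation \<delta>" and r: "r \<noteq> 0" "not_in i r" "u * F + v * \<delta> F = r"
      using assms[of i] unfolding coprime_in_def by blast
    \<comment> \<open>Since \<open>F\<close> contains \<open>h\<close> twice, \<open>h\<close>
      survives one differentiation and divides both \<open>F\<close> and
      \<open>\<delta> F\<close>.\<close>
    have "r = h * (u * (h * q) + v * \<delta> (h * q) + v * q * \<delta> h)"
      unfolding r(3)[symmetric] F by (simp add: derivation_mult[OF \<delta>] algebra_simps)
    with r show ?thesis
      by (metis mult_zero_left not_in_factor)
  qed
  then obtain c where c: "h = Const c"
    using Const_if_not_in_any by blast
  with * have "c \<noteq> 0"
    by (auto simp: Const_simps)
  then have "h * Const (inverse c) = 1"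
    unfolding c by (simp flip: Const_simps(2,4))
  then show "h dvd 1"
    by (metis dvd_triv_left)
qed

section \<open>Free submodules and interpolation\<close>

lemma sum_apply: "(\<Sum>s\<in>I. f s) x = (\<Sum>s\<in>I. f s x)"
  by (induction I rule: infinite_finite_induct) simp_all

text \<open>Freeness is defined through a set, so the family must also be injective. A repeated
  member would give a relation with coefficients 1 and -1.\<close>

lemma free_submodule_if_basis_family:
  fixes \<theta> :: "'i \<Rightarrow> 'a \<Rightarrow> 'r::comm_ring_1"
  assumes "finite I" "fun_module.subspace M" "\<And>s. s \<in> I \<Longrightarrow> \<theta> s \<in> M"
    and gen: "\<And>\<delta>. \<delta> \<in> M \<Longrightarrow> \<exists>b. \<delta> = (\<Sum>s\<in>I. scale_fun (b s) (\<theta> s))"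
    and indep: "\<And>b s. (\<Sum>s\<in>I. scale_fun (b s) (\<theta> s)) = 0 \<Longrightarrow> s \<in> I \<Longrightarrow> b s = 0"
  shows "free_submodule M"
  unfolding free_submodule_def
proof (intro exI[of _ "\<theta> ` I"] conjI)
  have inj: "inj_on \<theta> I"
  proof (rule inj_onI, rule ccontr)
    fix s t assume st: "s \<in> I" "t \<in> I" "\<theta> s = \<theta> t" "s \<noteq> t"
    define b :: "'i \<Rightarrow> 'r" where "b x = (if x = s then 1 else if x = t then - 1 else 0)" for x
    have "(\<Sum>x\<in>I. scale_fun (b x) (\<theta> x)) = (\<Sum>x\<in>{s, t}. scale_fun (b x) (\<theta> x))"
      using \<open>finite I\<close> st by (intro sum.mono_neutral_right) (auto simp: b_def)
    also have "\<dots> = 0"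
      using st by (simp add: b_def)
    finally have "b s = 0" using st(1) by (rule indep)
    then show False by (simp add: b_def)
  qed
  show "fun_module.independent (\<theta> ` I)"
    unfolding fun_module.dependent_finite[OF finite_imageI[OF \<open>finite I\<close>]]
    using indep[of "\<lambda>s. u (\<theta> s)" for u] by (auto simp: sum.reindex[OF inj])
  show "fun_module.span (\<theta> ` I) = M"
  proof
    show "fun_module.span (\<theta> ` I) \<subseteq> M"
      using assms(2,3) by (intro fun_module.span_minimal) auto
    show "M \<subseteq> fun_module.span (\<theta> ` I)"
    proof
      fix \<delta> assume "\<delta> \<in> M"
      then obtain b where "\<delta> = (\<Sum>s\<in>I. scale_fun (b s) (\<theta> s))"
        using gen by blast
      then show "\<delta> \<in> fun_module.span (\<theta> ` I)"
        by (simp only:) (intro fun_module.span_sum fun_module.span_scale fun_module.span_base imageI)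
    qed
  qed
qed

lemma poly_diff_dvd:
  fixes P :: "'r::comm_ring_1 poly"
  shows "a - b dvd poly P a - poly P b"
proof -
  have "poly (P - [:poly P b:]) b = 0" by simp
  then obtain Q where "P - [:poly P b:] = [:- b, 1:] * Q"
    unfolding poly_eq_0_iff_dvd by (elim dvdE)
  from arg_cong[OF this, of "\<lambda>p. poly p a"] show ?thesis
    by (simp flip: left_diff_distrib)
qed

text \<open>Newton interpolation: a new node is met by adding a multiple of the polynomial vanishing
  at the old nodes, and regularity makes the needed quotient exist in the ring. The degree bound is
  put on coefficients so that an empty \<open>A\<close> forces \<open>P = 0\<close>.\<close>

lemma interpolation_poly_exists:
  fixes y g :: "'i \<Rightarrow> 'r::idom"
  assumes "finite A"
    and "\<And>i j. i \<in> A \<Longrightarrow> j \<in> A \<Longrightarrow> i \<noteq> j \<Longrightarrow> y i - y j dvd g i - g j"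
    and "\<And>i j l. i \<in> A \<Longrightarrow> j \<in> A \<Longrightarrow> l \<in> A \<Longrightarrow> i \<noteq> j \<Longrightarrow> i \<noteq> l \<Longrightarrow> j \<noteq> l \<Longrightarrow>
      regular_mod (y i - y j) (y i - y l)"
  shows "\<exists>P. (\<forall>s\<ge>card A. coeff P s = 0) \<and> (\<forall>i\<in>A. poly P (y i) = g i)"
  using assms
proof (induction A)
  case empty
  show ?case by (rule exI[of _ 0]) simp
next
  case (insert a A)
  have "\<exists>P. (\<forall>s\<ge>card A. coeff P s = 0) \<and> (\<forall>i\<in>A. poly P (y i) = g i)"
    using insert.prems by (intro insert.IH) auto
  then obtain P where P: "\<And>s. s \<ge> card A \<Longrightarrow> coeff P s = 0" "\<And>i. i \<in> A \<Longrightarrow> poly P (y i) = g i"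
    by blast
  have "(\<Prod>j\<in>A. y a - y j) dvd g a - poly P (y a)"
  proof (rule prod_dvd_if_regular_mod)
    fix j assume j: "j \<in> A"
    \<comment> \<open>Because \<open>poly P (y j) = g j\<close>, this difference is
      \<open>g a - poly P (y a)\<close>.\<close>
    have "y a - y j dvd (g a - g j) - (poly P (y a) - poly P (y j))"
      using insert.hyps insert.prems(1)[of a j] j
      by (intro dvd_diff[OF _ poly_diff_dvd]) auto
    then show "y a - y j dvd g a - poly P (y a)"
      using P(2)[OF j] by simp
  next
    fix s t assume "s \<in> A" "t \<in> A" "s \<noteq> t"
    with insert.hyps show "regular_mod (y a - y s) (y a - y t)"
      by (intro insert.prems(2)) auto
  qed (use insert.hyps in auto)
  then obtain q where q: "g a - poly P (y a) = (\<Prod>j\<in>A. y a - y j) * q" ..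
  let ?L = "\<Prod>j\<in>A. [:- y j, 1:]"
  let ?Q = "P + smult q ?L"
  have "degree ?L \<le> (\<Sum>j\<in>A. degree [:- y j, 1:])"
    using degree_prod_sum_le[OF \<open>finite A\<close>, of "\<lambda>j. [:- y j, 1:]"] by (simp add: o_def)
  then have "degree ?L \<le> card A" by simp
  then have "\<forall>s\<ge>card (insert a A). coeff ?Q s = 0"
    using insert.hyps P(1) by (simp add: coeff_eq_0)
  moreover have "\<forall>i\<in>insert a A. poly ?Q (y i) = g i"
    using q P(2) insert.hyps by (auto simp: poly_prod algebra_simps prod_zero_iff)
  ultimately show ?case by blast
qed

lemma poly_eq_sum_lessThan:
  fixes P :: "'a::comm_semiring_1 poly"
  assumes "\<And>s. s \<ge> d \<Longrightarrow> coeff P s = 0"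
  shows "poly P x = (\<Sum>s<d. coeff P s * x ^ s)"
proof -
  have "(\<Sum>s<d. coeff P s * x ^ s) = (\<Sum>s<d + Suc (degree P). coeff P s * x ^ s)"
    using assms by (intro sum.mono_neutral_left) auto
  also have "\<dots> = (\<Sum>s\<le>degree P. coeff P s * x ^ s)"
    by (intro sum.mono_neutral_right) (auto simp: coeff_eq_0)
  finally show ?thesis
    by (simp add: poly_altdef[of P])
qed

section \<open>The factors of the defining polynomial\<close>

lemma not_in_Var_power_iff:
  fixes i :: "'n::{finite,linorder}"
  shows "not_in i (Var i ^ e :: ('n, 'k::idom) mpoly) \<longleftrightarrow> e = 0"
proof -
  have "degree ([:0, 1:] ^ e :: ('n, 'k) mpoly poly) = e"
    by (rule degree_linear_power)
  then show ?thesis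
    by (simp add: not_in_iff_degree as_poly_power as_poly_Var)
qed

lemma Var_nonzero: "Var i \<noteq> (0 :: ('n, 'k::zero_neq_one) mpoly)"
proof
  assume "Var i = (0 :: ('n, 'k) mpoly)"
  then have "Poly_Mapping.lookup (Var i :: ('n, 'k) mpoly) (Poly_Mapping.single i 1) = 0"
    by simp
  then show False by (simp add: Var_def)
qed

text \<open>A sum type indexes both kinds of factors, so that the defining polynomial becomes a
  single product.\<close>

definition factor :: "('n \<Rightarrow> nat) \<Rightarrow> 'n + 'n \<times> 'n \<Rightarrow> ('n, 'k::comm_ring_1) mpoly" where
  "factor n t = (case t of Inl i \<Rightarrow> Var i | Inr (i, j) \<Rightarrow> Var i ^ n i - Var j ^ n j)"

definition support :: "'n + 'n \<times> 'n \<Rightarrow> 'n set" where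
  "support t = (case t of Inl i \<Rightarrow> {i} | Inr (i, j) \<Rightarrow> {i, j})"

definition indices :: "nat \<Rightarrow> ('n::{finite,linorder} + 'n \<times> 'n) set" where
  "indices k = Inl ` first_elems k \<union> Inr ` {(i, j). i < j}"

lemma F_poly_eq_prod_factor:
  "F_poly n k = (prod (factor n) (indices k) :: ('n::{finite,linorder}, 'k::comm_ring_1) mpoly)"
proof -
  have "(prod (factor n) (indices k) :: ('n, 'k) mpoly) =
      prod (factor n) (Inl ` first_elems k) * prod (factor n) (Inr ` {(i, j). i < j})"
    unfolding indices_def by (rule prod.union_disjoint) auto
  then show ?thesis
    by (simp add: F_poly_def prod.reindex factor_def)
qed

text \<open>Pairs are ordered by \<open>i < j\<close>, so a pair is determined by its two-element
  set. Distinct factors can thus be told apart by a variable occurring in only one of them.\<close>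

lemma inj_on_support: "inj_on support (indices k)"
  by (rule inj_onI) (auto simp: indices_def support_def doubleton_eq_iff)

lemma not_in_factor_if_notin_support: "l \<notin> support t \<Longrightarrow> not_in l (factor n t)"
  by (auto simp: factor_def support_def not_in_Var intro!: not_in_diff not_in_power split: sum.splits)

lemma regular_mod_uminus_left: "regular_mod (- a) b \<longleftrightarrow> regular_mod a b"
  by (simp only: regular_mod_def minus_dvd_iff)

text \<open>From \<open>a * c = b * d\<close> regularity gives that \<open>a\<close> divides
  \<open>d\<close>; cancelling \<open>a\<close> leaves \<open>b\<close> dividing
  \<open>c\<close>.\<close>

lemma regular_mod_commute:
  fixes a b :: "'r::idom"
  assumes "regular_mod a b" "a \<noteq> 0"
  shows "regular_mod b a"
  unfolding regular_mod_def
proof (intro allI impI)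
  fix c assume "b dvd a * c"
  then obtain d where d: "a * c = b * d" ..
  then have "a dvd b * d" by (metis dvd_triv_left)
  with assms(1) have "a dvd d" by (rule regular_modD)
  then obtain e where "d = a * e" ..
  with d assms(2) show "b dvd c" by auto
qed

lemma coprime_in_uminus_left: "coprime_in i (- a) b \<longleftrightarrow> coprime_in i a b"
proof -
  have "coprime_in i (- a) b" if "coprime_in i a b" for a
  proof -
    from that obtain u v r where "r \<noteq> 0" "not_in i r" "u * a + v * b = r"
      unfolding coprime_in_def by blast
    then show ?thesis by (intro coprime_inI[of "- u" "- a" v b r]) simp_all
  qed
  from this[of a] this[of "- a"] show ?thesis by auto
qed

lemma coprime_in_uminus_right: "coprime_in i a (- b) \<longleftrightarrow> coprime_in i a b"
  using coprime_in_uminus_left coprime_in_commute by blast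

section \<open>Pairwise coprimality of the factors, and squarefreeness\<close>

context
  fixes n :: "'n::{finite,linorder} \<Rightarrow> nat"
  assumes n_pos: "n i > 0"
begin

lemma Var_power_neq:
  assumes "i \<noteq> j" shows "Var i ^ n i \<noteq> (Var j ^ n j :: ('n, 'k::idom) mpoly)"
  using not_in_Var_power_iff[of i "n i", where ?'k = 'k] n_pos[of i] assms
  by (metis less_irrefl not_in_Var not_in_power)

lemma factor_nonzero: "t \<in> indices k \<Longrightarrow> factor n t \<noteq> (0 :: ('n, 'k::idom) mpoly)"
  by (auto simp: factor_def indices_def Var_nonzero Var_power_neq)

text \<open>Any variable in the support may play the leading role; the sign absorbs the order of the
  pair.\<close>

lemma factor_cases:
  assumes "t \<in> indices k" "i \<in> support t"
  obtains "factor n t = (Var i :: ('n, 'k::idom) mpoly)" "t = Inl i"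
  | a where "a \<noteq> i" "support t = {i, a}"
      "factor n t = Var i ^ n i - (Var a ^ n a :: ('n, 'k) mpoly) \<or>
       factor n t = - (Var i ^ n i - (Var a ^ n a :: ('n, 'k) mpoly))"
proof (cases t)
  case (Inl j)
  with assms(2) that(1) show ?thesis
    by (simp add: factor_def support_def)
next
  case (Inr p)
  then obtain a b where t: "t = Inr (a, b)" "a < b"
    using assms(1) by (auto simp: indices_def)
  with assms(2) consider "i = a" | "i = b"
    by (auto simp: support_def)
  then show ?thesis
  proof cases
    case 1
    with t that(2)[of b] show ?thesis
      by (simp add: factor_def support_def)
  next
    case 2
    with t that(2)[of a] show ?thesis
      by (simp add: factor_def support_def insert_commute)
  qed
qed

lemma regular_mod_factor_aux:
  fixes b :: "('n, 'k::idom) mpoly"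
  assumes t: "t \<in> indices k" "i \<in> support t" and b: "b \<noteq> 0" "not_in i b"
  shows "regular_mod (factor n t) b"
proof (rule factor_cases[OF t, where ?'k = 'k])
  assume "factor n t = (Var i :: ('n, 'k) mpoly)"
  then show ?thesis
    using regular_mod_if_monic_in[of 1 i 0 b] b by (simp add: not_in_def)
next
  fix a assume "a \<noteq> i" and f: "factor n t = Var i ^ n i - (Var a ^ n a :: ('n, 'k) mpoly) \<or>
    factor n t = - (Var i ^ n i - (Var a ^ n a :: ('n, 'k) mpoly))"
  then have "regular_mod (Var i ^ n i - Var a ^ n a) b"
    using n_pos b by (intro regular_mod_if_monic_in) (auto intro: not_in_power not_in_Var)
  with f show ?thesis
    by (elim disjE) (simp_all only: regular_mod_uminus_left)
qed

text \<open>Some variable occurs in exactly one of the two factors. That factor is monic in it up to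
  sign, the other is free of it, and regularity is symmetric for nonzero elements.\<close>

lemma regular_mod_factor:
  assumes st: "s \<in> indices k" "t \<in> indices k" "s \<noteq> t"
  shows "regular_mod (factor n s :: ('n, 'k::idom) mpoly) (factor n t)"
proof -
  have "support s \<noteq> support t"
    using st inj_on_support by (auto dest: inj_onD)
  then consider l where "l \<in> support s" "l \<notin> support t" | l where "l \<in> support t" "l \<notin> support s"
    by blast
  then show ?thesis
  proof cases
    case 1
    with st show ?thesis
      by (intro regular_mod_factor_aux[of s k l] factor_nonzero[of t k] not_in_factor_if_notin_support)
  next
    case 2
    with st have "regular_mod (factor n t :: ('n, 'k) mpoly) (factor n s)"
      by (intro regular_mod_factor_aux[of t k l] factor_nonzero[of s k] not_in_factor_if_notin_support)
    then show ?thesis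
      using factor_nonzero[OF st(2)] by (rule regular_mod_commute)
  qed
qed

lemma coprime_in_factor:
  assumes st: "s \<in> indices k" "t \<in> indices k" "s \<noteq> t"
  shows "coprime_in i (factor n s :: ('n, 'k::idom) mpoly) (factor n t)"
proof (cases "i \<in> support s \<and> i \<in> support t")
  case False
  then consider "i \<notin> support s" | "i \<notin> support t" by blast
  then show ?thesis
  proof cases
    case 1
    with st(1) show ?thesis
      by (intro coprime_in_if_not_in factor_nonzero not_in_factor_if_notin_support)
  next
    case 2
    with st(2) show ?thesis
      unfolding coprime_in_commute[of i "factor n s"]
      by (intro coprime_in_if_not_in factor_nonzero not_in_factor_if_notin_support)
  qed
next
  case True
  let ?y = "\<lambda>i. Var i ^ n i :: ('n, 'k) mpoly"
  have nin: "not_in i (?y a)" if "a \<noteq> i" for a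
    using that by (intro not_in_power not_in_Var)
  \<comment> \<open>Subtracting the second element from a multiple of the first cancels
    \<open>?y i\<close> and leaves \<open>?y a\<close>.\<close>
  have VarP: "coprime_in i (Var i) (?y i - ?y a)" if "a \<noteq> i" for a
  proof (rule coprime_inI)
    show "Var i ^ (n i - 1) * Var i + (- 1) * (?y i - ?y a) = ?y a"
      using n_pos[of i] by (simp flip: power_Suc2)
  qed (use that nin in \<open>auto simp: Var_nonzero\<close>)
  have PP: "coprime_in i (?y i - ?y a) (?y i - ?y b)" if "a \<noteq> i" "b \<noteq> i" "a \<noteq> b" for a b
    by (rule coprime_inI[of 1 _ "- 1" _ "?y b - ?y a"])
       (use that nin in \<open>auto simp: Var_power_neq intro: not_in_diff\<close>)
  from st(1) True[THEN conjunct1] show ?thesis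
  proof (cases rule: factor_cases[where ?'k = 'k])
    case s: 1
    from st(2) True[THEN conjunct2] show ?thesis
    proof (cases rule: factor_cases[where ?'k = 'k])
      case 1 with s st(3) show ?thesis by simp
    next
      case (2 a)
      with s VarP[OF 2(1)] show ?thesis by (elim disjE) (simp_all only: coprime_in_uminus_right)
    qed
  next
    case s: (2 a)
    from st(2) True[THEN conjunct2] show ?thesis
    proof (cases rule: factor_cases[where ?'k = 'k])
      case 1
      with s VarP[OF s(1)] show ?thesis by (elim disjE) (simp_all only: coprime_in_uminus_left coprime_in_commute[of i _ "Var i"])
    next
      case (2 b)
      with s st have "a \<noteq> b"
        using inj_on_support[of k] by (metis inj_onD)
      from PP[OF s(1) 2(1) this] have PP': "coprime_in i (?y i - ?y a) (?y i - ?y b)" .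
      with s(3) 2(3) show ?thesis
        by (elim disjE) (simp_all only: coprime_in_uminus_left coprime_in_uminus_right)
    qed
  qed
qed

lemma coprime_in_derivation_factor:
  fixes \<delta> :: "('n, 'k::field_char_0) mpoly \<Rightarrow> ('n, 'k) mpoly"
  assumes \<delta>: "derivation \<delta>" "\<delta> (Var i) = 1" "\<And>j. j \<noteq> i \<Longrightarrow> \<delta> (Var j) = 0"
    and t: "t \<in> indices k"
  shows "coprime_in i (factor n t) (\<delta> (factor n t))"
proof (cases "i \<in> support t")
  case False
  with t show ?thesis
    by (intro coprime_in_if_not_in factor_nonzero not_in_factor_if_notin_support)
next
  case True
  let ?y = "\<lambda>i. Var i ^ n i :: ('n, 'k) mpoly"
  from t True show ?thesis
  proof (cases rule: factor_cases[where ?'k = 'k])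
    case 1
    with \<delta>(2) show ?thesis
      by (simp add: coprime_in_commute[of i _ 1] coprime_in_1)
  next
    case (2 a)
    have "\<delta> (?y i - ?y a) = of_nat (n i) * Var i ^ (n i - 1)"
      using \<delta> 2(1) by (simp add: derivation_diff derivation_power)
    moreover have "coprime_in i (?y i - ?y a) (of_nat (n i) * Var i ^ (n i - 1))"
    proof (rule coprime_inI)
      \<comment> \<open>Multiplying the derivative by \<open>Var i\<close> restores
        \<open>n i\<close> times \<open>?y i\<close>, so a combination eliminates
        \<open>Var i\<close>. What remains is nonzero in characteristic 0.\<close>
      have "Var i * Var i ^ (n i - 1) = ?y i"
        using n_pos[of i] by (simp flip: power_Suc)
      then show "- of_nat (n i) * (?y i - ?y a) + Var i * (of_nat (n i) * Var i ^ (n i - 1)) =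
          of_nat (n i) * ?y a"
        by (simp add: algebra_simps)
    qed (use 2(1) n_pos[of i] in \<open>auto simp: Var_nonzero intro!: not_in_mult not_in_of_nat not_in_power not_in_Var\<close>)
    ultimately have *: "coprime_in i (?y i - ?y a) (\<delta> (?y i - ?y a))" by simp
    moreover have "\<delta> (- (?y i - ?y a)) = - \<delta> (?y i - ?y a)"
      using derivation_diff[OF \<delta>(1), of 0 "?y i - ?y a"] by (simp add: derivation_0[OF \<delta>(1)])
    ultimately show ?thesis
      using 2(3) by (elim disjE) (simp_all only: coprime_in_uminus_left coprime_in_uminus_right)
  qed
qed

lemma squarefree_F_poly: "squarefree (F_poly n k :: ('n, 'k::field_char_0) mpoly)"
proof (rule squarefree_if_coprime_in_derivation)
  fix i
  let ?\<delta> = "vector_field (\<lambda>j. if j = i then 1 else 0) :: ('n, 'k) mpoly \<Rightarrow> _"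
  have "coprime_in i (F_poly n k) (?\<delta> (F_poly n k))"
    unfolding F_poly_eq_prod_factor
    by (rule coprime_in_derivation_prod[OF derivation_vector_field])
       (auto intro!: coprime_in_derivation_factor derivation_vector_field coprime_in_factor
         simp: vector_field_Var)
  then show "\<exists>\<delta>. derivation \<delta> \<and> coprime_in i (F_poly n k) (\<delta> (F_poly n k :: ('n, 'k) mpoly))"
    using derivation_vector_field by blast
qed

lemma Der_F_poly_iff:
  "\<delta> \<in> Der (F_poly n k :: ('n, 'k::idom) mpoly) \<longleftrightarrow> derivation \<delta> \<and>
    (\<forall>i\<in>first_elems k. Var i dvd \<delta> (Var i)) \<and>
    (\<forall>i j. i < j \<longrightarrow> Var i ^ n i - Var j ^ n j dvd \<delta> (Var i ^ n i) - \<delta> (Var j ^ n j))"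
proof (cases "derivation \<delta>")
  case True
  have "F_poly n k dvd \<delta> (F_poly n k) \<longleftrightarrow> (\<forall>t\<in>indices k. factor n t dvd \<delta> (factor n t))"
    unfolding F_poly_eq_prod_factor
    by (intro derivation_dvd_prod_iff True) (auto intro: regular_mod_factor)
  with True show ?thesis
    by (auto simp: Der_def indices_def factor_def ball_Un derivation_diff)
qed (simp add: Der_def)

section \<open>The basis of the derivation module\<close>

text \<open>
  The exponent of \<open>x\<^sub>i\<close> that divides \<open>\<delta> (x\<^sub>i ^ n\<^sub>i) = n\<^sub>i * x\<^sub>i ^ (n\<^sub>i - 1) * \<delta> x\<^sub>i\<close> for every \<open>\<delta> \<in> Der F\<^sub>k\<close>.
\<close>

definition vanishing_order :: "nat \<Rightarrow> 'n \<Rightarrow> nat" where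
  "vanishing_order k i = (if i \<in> first_elems k then n i else n i - 1)"

text \<open>The solution for \<open>\<theta> (Var i)\<close> of \<open>n i * Var i ^ (n i - 1) *
  \<theta> (Var i) = basis_value k s i\<close>.\<close>

definition basis_coeff :: "nat \<Rightarrow> nat \<Rightarrow> 'n \<Rightarrow> ('n, 'k::field_char_0) mpoly" where
  "basis_coeff k s i = Const (1 / of_nat (n i)) *
    (if s = 0 then (if i \<in> first_elems k then Var i else 1) * (\<Prod>j\<in>UNIV - {i}. Var j ^ vanishing_order k j)
     else Var i * (Var i ^ n i) ^ (s - 1))"

definition basis_value :: "nat \<Rightarrow> nat \<Rightarrow> 'n \<Rightarrow> ('n, 'k::field_char_0) mpoly" where
  "basis_value k s i = (if s = 0 then \<Prod>j\<in>UNIV. Var j ^ vanishing_order k j else (Var i ^ n i) ^ s)"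

abbreviation basis_field :: "nat \<Rightarrow> nat \<Rightarrow> ('n, 'k::field_char_0) mpoly \<Rightarrow> ('n, 'k) mpoly" where
  "basis_field k s \<equiv> vector_field (basis_coeff k s)"

lemma of_nat_mult_Const_inverse: "of_nat (n i) * Const (1 / of_nat (n i)) = (1 :: ('n, 'k::field_char_0) mpoly)"
proof -
  have "of_nat (n i) = (Const (of_nat (n i)) :: ('n, 'k) mpoly)"
    by (simp add: Const_def)
  then show ?thesis
    using n_pos[of i] by (simp flip: Const_simps(2,4))
qed

lemma basis_field_Var_power:
  "basis_field k s (Var i ^ n i) = (basis_value k s i :: ('n, 'k::field_char_0) mpoly)"
proof -
  let ?W = "\<Prod>j\<in>UNIV - {i}. Var j ^ vanishing_order k j :: ('n, 'k) mpoly"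
  have pow: "Var i ^ (n i - 1) * Var i = (Var i ^ n i :: ('n, 'k) mpoly)"
    using n_pos[of i] by (simp flip: power_Suc2)
  have W: "(\<Prod>j\<in>UNIV. Var j ^ vanishing_order k j) = Var i ^ vanishing_order k i * ?W"
    by (subst prod.remove[of _ i]) auto
  have "basis_field k s (Var i ^ n i) = of_nat (n i) * Const (1 / of_nat (n i)) *
      (Var i ^ (n i - 1) * (if s = 0 then (if i \<in> first_elems k then Var i else 1) * ?W
         else Var i * (Var i ^ n i) ^ (s - 1)))"
    by (simp add: derivation_power derivation_vector_field vector_field_Var basis_coeff_def mult_ac)
  also have "\<dots> = Var i ^ (n i - 1) * (if s = 0 then (if i \<in> first_elems k then Var i else 1) * ?W
         else Var i * (Var i ^ n i) ^ (s - 1))"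
    by (simp only: of_nat_mult_Const_inverse mult_1_left)
  also have "\<dots> = basis_value k s i"
  proof (cases "s = 0")
    case True
    have "Var i ^ (n i - 1) * (if i \<in> first_elems k then Var i else 1) =
        (Var i ^ vanishing_order k i :: ('n, 'k) mpoly)"
      using pow by (simp add: vanishing_order_def)
    with True show ?thesis
      by (simp only: basis_value_def W if_P[OF refl] flip: mult.assoc)
  next
    case False
    then have "Var i ^ n i * (Var i ^ n i) ^ (s - 1) = (Var i ^ n i :: ('n, 'k) mpoly) ^ s"
      by (simp flip: power_Suc)
    with False show ?thesis
      by (simp only: basis_value_def if_False pow flip: mult.assoc)
  qed
  finally show ?thesis .
qed

text \<open>For \<open>s = 0\<close> the values on all powers agree; for \<open>s > 0\<close> a
  difference divides the difference of \<open>s\<close>-th powers.\<close>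

lemma basis_field_in_Der: "basis_field k s \<in> Der (F_poly n k :: ('n, 'k::field_char_0) mpoly)"
  unfolding Der_F_poly_iff basis_field_Var_power
proof (intro conjI ballI allI impI)
  fix i j :: 'n
  show "Var i ^ n i - Var j ^ n j dvd (basis_value k s i - basis_value k s j :: ('n, 'k) mpoly)"
    using poly_diff_dvd[of "Var i ^ n i" "Var j ^ n j" "monom 1 s"]
    by (cases "s = 0") (simp_all add: basis_value_def poly_monom)
qed (simp_all add: derivation_vector_field vector_field_Var basis_coeff_def)

lemma prod_Var_power_dvd:
  fixes c :: "('n, 'k::field_char_0) mpoly"
  assumes "\<And>i. Var i ^ e i dvd c"
  shows "(\<Prod>i\<in>UNIV. Var i ^ e i) dvd c"
proof (rule prod_dvd_if_regular_mod)
  fix i j :: 'n assume "i \<noteq> j"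
  show "regular_mod (Var i ^ e i) (Var j ^ e j :: ('n, 'k) mpoly)"
  proof (cases "e i = 0")
    case False
    with \<open>i \<noteq> j\<close> show ?thesis
      using regular_mod_if_monic_in[of "e i" i 0 "Var j ^ e j"]
      by (simp add: Var_nonzero not_in_power not_in_Var) (simp add: not_in_def)
  qed (simp add: regular_mod_def)
qed (use assms in simp_all)

lemma derivation_eqI_Var_power:
  fixes \<delta> \<epsilon> :: "('n, 'k::field_char_0) mpoly \<Rightarrow> ('n, 'k) mpoly"
  assumes "derivation \<delta>" "derivation \<epsilon>" "\<And>i. \<delta> (Var i ^ n i) = \<epsilon> (Var i ^ n i)"
  shows "\<delta> = \<epsilon>"
proof (rule derivation_eqI[OF assms(1,2)])
  fix i
  show "\<delta> (Var i) = \<epsilon> (Var i)"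
    using assms(3)[of i] n_pos[of i] by (simp add: derivation_power assms(1,2) Var_nonzero)
qed

lemma Der_F_poly_generated:
  fixes \<delta> :: "('n, 'k::field_char_0) mpoly \<Rightarrow> ('n, 'k) mpoly"
  assumes "\<delta> \<in> Der (F_poly n k)"
  shows "\<exists>b. \<delta> = (\<Sum>s<CARD('n). scale_fun (b s) (basis_field k s))"
proof -
  let ?y = "\<lambda>i. Var i ^ n i :: ('n, 'k) mpoly"
  let ?W = "\<Prod>i\<in>UNIV. Var i ^ vanishing_order k i :: ('n, 'k) mpoly"
  have \<delta>: "derivation \<delta>" and \<delta>_Var: "\<And>i. i \<in> first_elems k \<Longrightarrow> Var i dvd \<delta> (Var i)"
    and \<delta>_less: "\<And>i j. i < j \<Longrightarrow> ?y i - ?y j dvd \<delta> (?y i) - \<delta> (?y j)"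
    using assms unfolding Der_F_poly_iff by blast+
  have \<delta>_diff: "?y i - ?y j dvd \<delta> (?y i) - \<delta> (?y j)" if "i \<noteq> j" for i j
    using \<delta>_less[of i j] \<delta>_less[of j i] that by (metis dvd_minus_iff linorder_neqE minus_diff_eq minus_dvd_iff)
  have reg: "regular_mod (?y i - ?y j) (?y i - ?y l)" if "i \<noteq> j" "i \<noteq> l" "j \<noteq> l" for i j l
  proof -
    \<comment> \<open>With the sign turned, the modulus is monic in \<open>Var j\<close>, which the
      other difference does not contain.\<close>
    have "regular_mod (?y j - ?y i) (?y i - ?y l)"
      using that n_pos Var_power_neq[of i l, where ?'k = 'k]
      by (intro regular_mod_if_monic_in not_in_diff not_in_power not_in_Var) auto
    then show ?thesis
      using regular_mod_uminus_left[of "?y j - ?y i"] by simp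
  qed
  obtain P where P: "\<And>s. s \<ge> CARD('n) \<Longrightarrow> coeff P s = 0" "\<And>i. poly P (?y i) = \<delta> (?y i)"
    using interpolation_poly_exists[of UNIV ?y "\<lambda>i. \<delta> (?y i)"] \<delta>_diff reg by auto
  have "Var i ^ vanishing_order k i dvd coeff P 0" for i
  proof -
    have \<delta>_y: "\<delta> (?y i) = of_nat (n i) * (Var i ^ (n i - 1) * \<delta> (Var i))"
      by (simp add: derivation_power \<delta> mult.assoc)
    have "Var i ^ vanishing_order k i dvd Var i ^ (n i - 1) * \<delta> (Var i)"
    proof (cases "i \<in> first_elems k")
      case True
      have "Var i ^ vanishing_order k i = Var i ^ (n i - 1) * (Var i :: ('n, 'k) mpoly)"
        using True n_pos[of i] by (simp add: vanishing_order_def flip: power_Suc2)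
      with \<delta>_Var[OF True] show ?thesis
        by (simp add: mult_dvd_mono)
    qed (simp add: vanishing_order_def)
    then have 1: "Var i ^ vanishing_order k i dvd poly P (?y i)"
      by (simp add: P(2) \<delta>_y)
    \<comment> \<open>Splitting off the constant coefficient,
      \<open>poly P (?y i) = c + ?y i * poly Q (?y i)\<close>; the power divides the left side and
      \<open>?y i\<close>, hence \<open>c\<close>.\<close>
    obtain c Q where cQ: "P = pCons c Q" by (cases P)
    have "Var i ^ vanishing_order k i dvd ?y i"
      by (rule le_imp_power_dvd) (simp add: vanishing_order_def)
    then have "Var i ^ vanishing_order k i dvd ?y i * poly Q (?y i)" by simp
    with 1 show ?thesis
      by (simp add: cQ dvd_add_left_iff)
  qed
  then have "?W dvd coeff P 0"
    by (rule prod_Var_power_dvd)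
  then obtain \<rho> where \<rho>: "coeff P 0 = ?W * \<rho>" ..
  \<comment> \<open>The field for \<open>s = 0\<close> takes the value \<open>?W\<close> where
    interpolation has 1, so its coefficient is the quotient by \<open>?W\<close>.\<close>
  define b where "b s = (if s = 0 then \<rho> else coeff P s)" for s
  let ?\<epsilon> = "\<Sum>s<CARD('n). scale_fun (b s) (basis_field k s)"
  have "?\<epsilon> \<in> Der (F_poly n k)"
    by (intro fun_module.subspace_sum subspace_Der fun_module.subspace_scale basis_field_in_Der)
  then have "derivation ?\<epsilon>" by (simp add: Der_def)
  with \<delta> have "\<delta> = ?\<epsilon>"
  proof (rule derivation_eqI_Var_power)
    fix i
    have "\<delta> (?y i) = (\<Sum>s<CARD('n). coeff P s * ?y i ^ s)"
      using poly_eq_sum_lessThan[OF P(1)] P(2) by metis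
    also have "\<dots> = (\<Sum>s<CARD('n). b s * basis_value k s i)"
      by (rule sum.cong) (auto simp: b_def basis_value_def \<rho> mult.commute)
    also have "\<dots> = ?\<epsilon> (?y i)"
      by (simp add: sum_apply scale_fun_def basis_field_Var_power)
    finally show "\<delta> (?y i) = ?\<epsilon> (?y i)" .
  qed
  then show ?thesis by blast
qed

text \<open>Applied to the powers \<open>Var i ^ n i\<close>, a relation becomes a polynomial of
  degree below \<open>CARD('n)\<close> with \<open>CARD('n)\<close> distinct roots, hence zero; the
  nonzero product of variable powers in its constant coefficient then cancels.\<close>

lemma basis_field_independent:
  fixes b :: "nat \<Rightarrow> ('n, 'k::field_char_0) mpoly"
  assumes zero: "(\<Sum>s<CARD('n). scale_fun (b s) (basis_field k s)) = 0" and s: "s < CARD('n)"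
  shows "b s = 0"
proof -
  let ?y = "\<lambda>i. Var i ^ n i :: ('n, 'k) mpoly"
  let ?W = "\<Prod>i\<in>UNIV. Var i ^ vanishing_order k i :: ('n, 'k) mpoly"
  define d where "d s = (if s = 0 then ?W * b s else b s)" for s
  define P where "P = (\<Sum>s<CARD('n). monom (d s) s)"
  have coeff_P: "coeff P s = (if s < CARD('n) then d s else 0)" for s
    by (simp add: P_def coeff_sum)
  have root: "poly P (?y i) = 0" for i
  proof -
    have "poly P (?y i) = (\<Sum>s<CARD('n). b s * basis_value k s i)"
      unfolding P_def poly_sum
      by (rule sum.cong) (auto simp: d_def basis_value_def poly_monom mult.commute)
    also have "\<dots> = (\<Sum>s<CARD('n). scale_fun (b s) (basis_field k s)) (?y i)"
      by (simp add: sum_apply scale_fun_def basis_field_Var_power)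
    finally show ?thesis by (simp add: zero)
  qed
  have "inj ?y"
    using Var_power_neq[where ?'k = 'k] by (auto intro!: injI)
  then have card: "card (range ?y) = CARD('n)"
    by (rule card_image)
  have "degree P < CARD('n)"
    by (rule degree_lessI) (auto simp: coeff_P)
  then have "P = 0"
    using root card by (intro poly_eqI_degree[of "range ?y"]) auto
  with coeff_P[of s] s have "d s = 0" by simp
  then show ?thesis
    by (auto simp: d_def Var_nonzero split: if_splits)
qed

end

theorem corollary6p7:
  fixes n :: "'n::{finite,linorder} \<Rightarrow> nat" and k :: nat
  assumes "CARD('n) \<ge> 2" and "k \<le> CARD('n)" and "\<And>i. n i > 0"
  shows "free_divisor (F_poly n k :: ('n, 'k::field_char_0) mpoly)"
  unfolding free_divisor_def
proof
  show "squarefree (F_poly n k :: ('n, 'k) mpoly)"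
    using assms(3) by (rule squarefree_F_poly)
  show "free_submodule (Der (F_poly n k :: ('n, 'k) mpoly))"
    using basis_field_in_Der[OF assms(3)] Der_F_poly_generated[OF assms(3)]
      basis_field_independent[OF assms(3)]
    by (intro free_submodule_if_basis_family[of "{..<CARD('n)}" _ "\<lambda>s. vector_field (basis_coeff n k s)"])
       (auto intro: subspace_Der)
qed

end
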